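(* Let $\mathcal L=\{L_1,\dots,L_s\}$ be $s\ge3$ distinct skew lines in $\mathbb P^3_K$, $K$ a field. Let $p\in L_i$. Then $[p]_i=\{p\}$ if and only if $p\in T$ for some transversal $T$ for $\mathcal L$, in which case $[p]=T\cap(\bigcup_j L_j)$. In particular, $|G_i|=1$ if and only if the lines $L_j$ are all contained in a smooth quadric.
   Context: For distinct $i,j,k$ let $f_{ijk}\colon L_i\to L_j$ be the linear isomorphism sending $p\in L_i$ to the point where the plane spanned by $p$ and $L_k$ meets $L_j$. The groupoid $C_{\mathcal L}$ has the lines $L_i$ as objects and all possible compositions of the maps $f_{ijk}$ as arrows. Put $G_i=\mathrm{Hom}_{C_{\mathcal L}}(L_i,L_i)$. For $p\in L_i$, its orbit is $[p]=\bigcup_j\{g(p):g\in\mathrm{Hom}_{C_{\mathcal L}}(L_i,L_j)\}$, and $[p]_j=[p]\cap L_j$. A transversal for $\mathcal L$ is a line meeting every line of $\mathcal L$. "Smooth quadric" means a smooth quadric surface in $\mathbb P^3$. *)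

theory Defs
  imports "HOL-Analysis.Cartesian_Space" "HOL-Algebra.Algebraic_Closure_Type"
begin

text \<open>
  Projective 3-space over a field is the lattice of linear subspaces of the 4-dimensional
  coordinate space: points, lines and planes are the subspaces of dimension 1, 2 and 3.
\<close>

definition proj_point :: "('a::field ^ 4) set \<Rightarrow> bool" where
  "proj_point p \<longleftrightarrow> vec.subspace p \<and> vec.dim p = 1"

definition proj_line :: "('a::field ^ 4) set \<Rightarrow> bool" where
  "proj_line M \<longleftrightarrow> vec.subspace M \<and> vec.dim M = 2"

definition points_of :: "('a::field ^ 4) set \<Rightarrow> ('a ^ 4) set set" where
  "points_of M = {p. proj_point p \<and> p \<subseteq> M}"

definition meets :: "('a::field ^ 4) set \<Rightarrow> ('a ^ 4) set \<Rightarrow> bool" where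
  "meets M N \<longleftrightarrow> points_of M \<inter> points_of N \<noteq> {}"

definition proj_join :: "('a::field ^ 4) set \<Rightarrow> ('a ^ 4) set \<Rightarrow> ('a ^ 4) set" where
  "proj_join M N = vec.span (M \<union> N)"

definition skew_lines :: "nat \<Rightarrow> (nat \<Rightarrow> ('a::field ^ 4) set) \<Rightarrow> bool" where
  "skew_lines s L \<longleftrightarrow>
     (\<forall>i\<in>{1..s}. proj_line (L i)) \<and>
     inj_on L {1..s} \<and>
     (\<forall>i\<in>{1..s}. \<forall>j\<in>{1..s}. i \<noteq> j \<longrightarrow> \<not> meets (L i) (L j))"

definition transversal :: "nat \<Rightarrow> (nat \<Rightarrow> ('a::field ^ 4) set) \<Rightarrow> ('a ^ 4) set \<Rightarrow> bool" where
  "transversal s L T \<longleftrightarrow> proj_line T \<and> (\<forall>j\<in>{1..s}. meets T (L j))"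

text \<open>
  Maps between lines are extensional functions on the points of the source.  Every projective line
  has at least three points over its base field, so this determines a projective linear
  isomorphism.
\<close>

definition line_map ::
  "(nat \<Rightarrow> ('a::field ^ 4) set) \<Rightarrow> nat \<Rightarrow> nat \<Rightarrow> nat \<Rightarrow> ('a ^ 4) set \<Rightarrow> ('a ^ 4) set" where
  "line_map L i j k = (\<lambda>p\<in>points_of (L i). proj_join p (L k) \<inter> L j)"

inductive arrow ::
  "nat \<Rightarrow> (nat \<Rightarrow> ('a::field ^ 4) set) \<Rightarrow> nat \<Rightarrow> nat \<Rightarrow> (('a ^ 4) set \<Rightarrow> ('a ^ 4) set) \<Rightarrow> bool"
  for s L where
  gen: "\<lbrakk>i \<in> {1..s}; j \<in> {1..s}; k \<in> {1..s}; i \<noteq> j; j \<noteq> k; i \<noteq> k\<rbrakk>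
    \<Longrightarrow> arrow s L i j (line_map L i j k)"
| ident: "i \<in> {1..s} \<Longrightarrow> arrow s L i i (\<lambda>p\<in>points_of (L i). p)"
| comp: "\<lbrakk>arrow s L i j g; arrow s L j k h\<rbrakk>
    \<Longrightarrow> arrow s L i k (compose (points_of (L i)) h g)"

definition Hom_C ::
  "nat \<Rightarrow> (nat \<Rightarrow> ('a::field ^ 4) set) \<Rightarrow> nat \<Rightarrow> nat \<Rightarrow> (('a ^ 4) set \<Rightarrow> ('a ^ 4) set) set" where
  "Hom_C s L i j = {g. arrow s L i j g}"

definition vertex_group ::
  "nat \<Rightarrow> (nat \<Rightarrow> ('a::field ^ 4) set) \<Rightarrow> nat \<Rightarrow> (('a ^ 4) set \<Rightarrow> ('a ^ 4) set) set" where
  "vertex_group s L i = Hom_C s L i i"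

text \<open>The index \<open>i\<close> is that of the line containing \<open>p\<close>.\<close>

definition line_orbit ::
  "nat \<Rightarrow> (nat \<Rightarrow> ('a::field ^ 4) set) \<Rightarrow> nat \<Rightarrow> ('a ^ 4) set \<Rightarrow> ('a ^ 4) set set" where
  "line_orbit s L i p = (\<Union>j\<in>{1..s}. {g p | g. g \<in> Hom_C s L i j})"

definition line_orbit_on ::
  "nat \<Rightarrow> (nat \<Rightarrow> ('a::field ^ 4) set) \<Rightarrow> nat \<Rightarrow> ('a ^ 4) set \<Rightarrow> nat \<Rightarrow> ('a ^ 4) set set" where
  "line_orbit_on s L i p j = line_orbit s L i p \<inter> points_of (L j)"

text \<open>
  In every characteristic, each quadratic form is
  \<open>(\<Sum>i j. A $ i $ j * x $ i * x $ j)\<close> for some (not necessarily symmetric, not unique) matrix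
  \<open>A\<close>.  Its formal partial derivative with respect to the variable \<open>x $ k\<close> is
  \<open>(\<Sum>j. (A $ k $ j + A $ j $ k) * x $ j)\<close>.
\<close>

definition quad_form :: "'a::field ^ 4 ^ 4 \<Rightarrow> 'a ^ 4 \<Rightarrow> 'a" where
  "quad_form A x = (\<Sum>i\<in>UNIV. \<Sum>j\<in>UNIV. A $ i $ j * x $ i * x $ j)"

definition quad_partial :: "'a::field ^ 4 ^ 4 \<Rightarrow> 4 \<Rightarrow> 'a ^ 4 \<Rightarrow> 'a" where
  "quad_partial A k x = (\<Sum>j\<in>UNIV. (A $ k $ j + A $ j $ k) * x $ j)"

definition quadric_points :: "'a::field ^ 4 ^ 4 \<Rightarrow> ('a ^ 4) set set" where
  "quadric_points A = {p. proj_point p \<and> (\<forall>x\<in>p. quad_form A x = 0)}"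

text \<open>
  Jacobian criterion over the algebraic closure.  The zero form is excluded automatically.
  The equation itself is listed along with the partial derivatives, because Euler's relation does
  not recover it in characteristic 2.
\<close>

definition smooth_quadric :: "'a::field ^ 4 ^ 4 \<Rightarrow> bool" where
  "smooth_quadric A \<longleftrightarrow>
     (let A' = (\<chi> i j. to_ac (A $ i $ j)) in
      \<not> (\<exists>x. x \<noteq> 0 \<and> quad_form A' x = 0 \<and> (\<forall>k. quad_partial A' k x = 0)))"

end

theory Submission
  imports Defs
begin

text \<open>
  If \<open>x = y + z\<close> with \<open>x \<in> L i\<close>, \<open>y \<in> L j\<close>, \<open>z \<in> L k\<close>, then the line map sends the point of
  \<open>x\<close> to the point of \<open>y\<close>, and every transversal through \<open>x\<close> contains \<open>y\<close> and \<open>z\<close>.  So arrows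
  move points along transversals.  Conversely, if the vertex group fixes the point of \<open>x\<close>, then
  the image on \<open>L j\<close> does not depend on the third line used, and the line joining \<open>x\<close> and \<open>y\<close>
  meets every line.

  On a smooth quadric containing the lines, the transversal through \<open>x\<close> is the residual line of the
  tangent plane section at \<open>x\<close>.  Conversely, if every point of \<open>L i\<close> lies on a transversal, the
  transversals through points of \<open>L i\<close> sweep out the quadric \<open>a1 * b2 = a2 * b1\<close>, in coordinates
  adapted to three of the lines; any further line meets at least three of them, hence lies on it.
\<close>

no_notation fps_nth (infixl "$" 75)

section \<open>Points and lines\<close>

lemma span_pair_iff:
  fixes x y v :: "'a::field ^ 'n"
  shows "v \<in> vec.span {x, y} \<longleftrightarrow> (\<exists>a b. v = a *s x + b *s y)"
proof -
  have "v \<in> vec.span {x, y} \<longleftrightarrow> (\<exists>a b. v - a *s x = b *s y)"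
    by (auto simp: vec.span_breakdown_eq[of _ x] vec.span_singleton)
  then show ?thesis
    by (simp add: diff_eq_eq add.commute)
qed

lemma proj_point_iff: "proj_point p \<longleftrightarrow> (\<exists>x. x \<noteq> 0 \<and> p = vec.span {x})"
proof
  assume p: "proj_point p"
  then have "p \<noteq> {0}"
    by (auto simp: proj_point_def)
  then obtain x where x: "x \<in> p" "x \<noteq> 0"
    using p vec.subspace_0 unfolding proj_point_def by blast
  have "vec.span {x} = p"
    using p x by (intro vec.subspace_dim_equal) (auto simp: proj_point_def vec.span_minimal)
  with x show "\<exists>x. x \<noteq> 0 \<and> p = vec.span {x}"
    by blast
qed (auto simp: proj_point_def)

lemma span_singleton_eq_iff:
  fixes x y :: "'a::field ^ 'n"
  assumes "y \<noteq> 0"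
  shows "vec.span {x} = vec.span {y} \<longleftrightarrow> (\<exists>c. c \<noteq> 0 \<and> y = c *s x)"
proof
  assume "vec.span {x} = vec.span {y}"
  then have "y \<in> vec.span {x}"
    by (simp add: vec.span_base)
  with assms show "\<exists>c. c \<noteq> 0 \<and> y = c *s x"
    by (auto simp: vec.span_singleton)
next
  assume "\<exists>c. c \<noteq> 0 \<and> y = c *s x"
  then obtain c where c: "c \<noteq> 0" "y = c *s x"
    by blast
  then have "x = inverse c *s y"
    by simp
  with c have "x \<in> vec.span {y}" "y \<in> vec.span {x}"
    by (metis insertI1 vec.span_base vec.span_scale)+
  then show "vec.span {x} = vec.span {y}"
    by (simp add: vec.span_eq)
qed

lemma points_of_iff:
  assumes "vec.subspace M"
  shows "p \<in> points_of M \<longleftrightarrow> (\<exists>x\<in>M. x \<noteq> 0 \<and> p = vec.span {x})"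
  using assms vec.span_minimal[of "{_}" M] vec.span_base[of _ "{_}"]
  unfolding points_of_def proj_point_iff by blast

lemma span_in_points_of:
  assumes "vec.subspace M" "x \<noteq> 0"
  shows "vec.span {x} \<in> points_of M \<longleftrightarrow> x \<in> M"
  using assms vec.span_minimal[of "{x}" M] vec.span_base[of x "{x}"]
  unfolding points_of_def proj_point_iff by blast

lemma meets_iff:
  assumes "vec.subspace M" "vec.subspace N"
  shows "meets M N \<longleftrightarrow> (\<exists>x. x \<in> M \<and> x \<in> N \<and> x \<noteq> 0)"
proof
  assume "meets M N"
  then obtain p where "p \<in> points_of M" "p \<in> points_of N"
    by (auto simp: meets_def)
  then obtain x where "x \<in> M" "x \<noteq> 0" "vec.span {x} \<in> points_of N"
    using assms by (auto simp: points_of_iff[OF assms(1)])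
  then show "\<exists>x. x \<in> M \<and> x \<in> N \<and> x \<noteq> 0"
    using span_in_points_of[OF assms(2)] by blast
next
  assume "\<exists>x. x \<in> M \<and> x \<in> N \<and> x \<noteq> 0"
  then show "meets M N"
    using assms unfolding meets_def by (metis disjoint_iff span_in_points_of)
qed

lemma proj_line_subspace: "proj_line M \<Longrightarrow> vec.subspace M"
  by (simp add: proj_line_def)

lemma dim_span_pair:
  fixes x y :: "'a::field ^ 'n"
  assumes "x \<noteq> 0" "y \<notin> vec.span {x}"
  shows "vec.dim (vec.span {x, y}) = 2"
  using assms by (simp add: vec.dim_insert[of y "{x}"] insert_commute[of x y])

lemma proj_line_span_pair:
  assumes "x \<noteq> 0" "y \<notin> vec.span {x}"
  shows "proj_line (vec.span {x, y})"
  unfolding proj_line_def using dim_span_pair[OF assms] by simp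

lemma proj_line_eq_span_pair:
  assumes "proj_line M" "x \<in> M" "y \<in> M" "x \<noteq> 0" "y \<notin> vec.span {x}"
  shows "M = vec.span {x, y}"
  using assms dim_span_pair[OF assms(4,5)]
  by (intro vec.subspace_dim_equal[symmetric]) (auto simp: proj_line_def vec.span_minimal)

lemma proj_line_nonzero:
  assumes "proj_line M"
  obtains x where "x \<in> M" "x \<noteq> 0"
  using assms vec.dim_eq_0[of M] by (force simp: proj_line_def)

lemma proj_line_basis:
  assumes "proj_line M" "x \<in> M" "x \<noteq> 0"
  obtains y where "y \<in> M" "y \<notin> vec.span {x}" "M = vec.span {x, y}"
proof -
  have "\<not> M \<subseteq> vec.span {x}"
    using vec.dim_subset[of M "vec.span {x}"] assms by (auto simp: proj_line_def)
  then show ?thesis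
    using that proj_line_eq_span_pair assms by blast
qed

section \<open>Skew lines, arrows and transversals\<close>

lemma skew_linesD:
  assumes "skew_lines s L" "i \<in> {1..s}"
  shows "proj_line (L i)" "vec.subspace (L i)"
  using assms by (auto simp: skew_lines_def intro: proj_line_subspace)

lemma skew_lines_Int:
  assumes "skew_lines s L" "i \<in> {1..s}" "j \<in> {1..s}" "i \<noteq> j" "x \<in> L i" "x \<in> L j"
  shows "x = 0"
  using assms meets_iff[OF skew_linesD(2) skew_linesD(2)] by (metis skew_lines_def)

text \<open>Two skew lines are 2-dimensional subspaces with intersection \<open>0\<close>, so their
  sum has dimension 4 and is the whole space.\<close>

lemma skew_lines_decomp:
  fixes x :: "'a::field ^ 4"
  assumes sk: "skew_lines s L" and ij: "i \<in> {1..s}" "j \<in> {1..s}" "i \<noteq> j"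
  obtains y z where "y \<in> L i" "z \<in> L j" "x = y + z"
proof -
  let ?S = "{y + z | y z. y \<in> L i \<and> z \<in> L j}"
  note sub = skew_linesD(2)[OF sk ij(1)] skew_linesD(2)[OF sk ij(2)]
  have "L i \<inter> L j = {0}"
    using skew_lines_Int[OF sk ij] sub vec.subspace_0 by blast
  then have "vec.dim ?S = 4"
    using vec.dim_sums_Int[OF sub] skew_linesD(1)[OF sk] ij by (simp add: proj_line_def)
  then have "?S = UNIV"
    using vec.subspace_dim_equal[OF vec.subspace_sums[OF sub] vec.subspace_UNIV]
    by (simp only: vec_dim_card) simp
  then show ?thesis
    using that by blast
qed

lemma skew_lines_decomp_unique:
  assumes sk: "skew_lines s L" and ij: "i \<in> {1..s}" "j \<in> {1..s}" "i \<noteq> j"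
    and "y \<in> L i" "z \<in> L j" "y' \<in> L i" "z' \<in> L j" "y + z = y' + z'"
  shows "y = y'" "z = z'"
proof -
  have eq: "y - y' = z' - z"
    using assms by (simp add: algebra_simps)
  moreover have "y - y' \<in> L i" "z' - z \<in> L j"
    using assms by (auto intro!: vec.subspace_diff skew_linesD(2)[OF sk])
  ultimately have "y - y' = 0"
    using skew_lines_Int[OF sk ij] by metis
  with eq show "y = y'" "z = z'"
    by simp_all
qed

text \<open>If a summand vanished, \<open>x\<close> would lie on two of the lines.\<close>

lemma skew_lines_decomp_nonzero:
  assumes sk: "skew_lines s L" and ijk: "i \<in> {1..s}" "j \<in> {1..s}" "k \<in> {1..s}"
      "i \<noteq> j" "j \<noteq> k" "i \<noteq> k"
    and x: "x \<in> L i" "x \<noteq> 0" "y \<in> L j" "z \<in> L k" "x = y + z"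
  shows "y \<noteq> 0" "z \<noteq> 0"
  using skew_lines_Int[OF sk ijk(1,2,4), of x] skew_lines_Int[OF sk ijk(1,3,6), of x] x by auto

text \<open>Since \<open>y = x - z\<close>, the vector \<open>y\<close> lies on \<open>L j\<close>
  and in the plane joining \<open>x\<close> to \<open>L k\<close>; uniqueness of decompositions
  shows that the intersection is no larger. Later evaluations of \<open>line_map\<close> at a point
  use this vector form.\<close>

lemma line_map_span:
  assumes sk: "skew_lines s L" and ijk: "i \<in> {1..s}" "j \<in> {1..s}" "k \<in> {1..s}"
      "i \<noteq> j" "j \<noteq> k" "i \<noteq> k"
    and x: "x \<in> L i" "x \<noteq> 0" "y \<in> L j" "z \<in> L k" "x = y + z"
  shows "line_map L i j k (vec.span {x}) = vec.span {y}"
proof -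
  note sub = skew_linesD(2)[OF sk]
  have "v \<in> proj_join (vec.span {x}) (L k) \<inter> L j \<longleftrightarrow> v \<in> vec.span {y}" for v
  proof
    assume "v \<in> proj_join (vec.span {x}) (L k) \<inter> L j"
    moreover have "vec.span (L k) = L k"
      using sub[OF ijk(3)] by (simp only: vec.span_eq_iff)
    ultimately obtain c w where w: "w \<in> L k" "v = c *s x + w" "v \<in> L j"
      unfolding proj_join_def vec.span_Un vec.span_span by (auto simp: vec.span_singleton)
    \<comment> \<open>Both sides decompose \<open>v\<close> along \<open>L j\<close> and
      \<open>L k\<close>, so their parts on \<open>L j\<close> agree.\<close>
    have "v + 0 = c *s y + (c *s z + w)"
      using w x by (simp add: vec.scale_right_distrib)
    moreover have "0 \<in> L k" "c *s y \<in> L j" "c *s z + w \<in> L k"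
      using w x sub ijk by (simp_all add: vec.subspace_0 vec.subspace_add vec.subspace_scale)
    ultimately have "v = c *s y"
      using skew_lines_decomp_unique(1)[OF sk ijk(2,3,5) w(3)] by blast
    then show "v \<in> vec.span {y}"
      by (auto simp: vec.span_singleton)
  next
    assume "v \<in> vec.span {y}"
    then obtain c where c: "v = c *s y"
      by (auto simp: vec.span_singleton)
    have "v = c *s x + (- c) *s z"
      using c x by (simp add: vec.scale_right_distrib)
    moreover have "c *s x \<in> vec.span {x}" "(- c) *s z \<in> L k" "v \<in> L j"
      using x sub ijk c by (auto intro: vec.subspace_scale vec.subspace_neg vec.span_scale vec.span_base)
    ultimately show "v \<in> proj_join (vec.span {x}) (L k) \<inter> L j"
      unfolding proj_join_def by (metis IntI UnCI vec.span_add vec.span_base)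
  qed
  moreover have "vec.span {x} \<in> points_of (L i)"
    using span_in_points_of[OF sub] ijk x by blast
  ultimately show ?thesis
    unfolding line_map_def by auto
qed

text \<open>For a generator the image is a genuine point because the summand \<open>y\<close> is
  nonzero. Extensionality is recorded as well, so that arrows with the same values on points can be
  proved equal.\<close>

lemma arrow_PiE:
  assumes sk: "skew_lines s L" and "arrow s L i j g"
  shows "i \<in> {1..s}" "j \<in> {1..s}" "g \<in> points_of (L i) \<rightarrow>\<^sub>E points_of (L j)"
  using assms(2)
proof induction
  case (gen i j k)
  note sub = skew_linesD(2)[OF sk]
  {
    case 1 then show ?case using gen by simp
  next
    case 2 then show ?case using gen by simp
  next
    case 3
    have "line_map L i j k p \<in> points_of (L j)" if "p \<in> points_of (L i)" for p
    proof -
      obtain x where x: "x \<in> L i" "x \<noteq> 0" "p = vec.span {x}"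
        using \<open>p \<in> points_of (L i)\<close> points_of_iff[OF sub] gen by blast
      obtain y z where yz: "y \<in> L j" "z \<in> L k" "x = y + z"
        using skew_lines_decomp[OF sk] gen by blast
      show ?thesis
        using line_map_span[OF sk gen x(1,2) yz] skew_lines_decomp_nonzero[OF sk gen x(1,2) yz]
          span_in_points_of[OF sub] gen yz x by simp
    qed
    then show ?case
      by (auto simp: line_map_def)
  }
qed (auto simp: compose_def)

section \<open>Transversals and the arrows along them\<close>

lemma transversal_meet:
  assumes "skew_lines s L" "transversal s L T" "j \<in> {1..s}"
  obtains y where "y \<in> T" "y \<in> L j" "y \<noteq> 0"
  using assms meets_iff[OF proj_line_subspace skew_linesD(2)] unfolding transversal_def by meson

text \<open>If \<open>x\<close> and \<open>y\<close> were independent, \<open>T\<close> would equal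
  \<open>L i\<close> and could not meet the second line \<open>L j\<close>.\<close>

lemma transversal_Int:
  assumes sk: "skew_lines s L" and T: "transversal s L T"
    and ij: "i \<in> {1..s}" "j \<in> {1..s}" "i \<noteq> j"
    and x: "x \<in> T" "x \<in> L i" "x \<noteq> 0" "y \<in> T" "y \<in> L i" "y \<noteq> 0"
  shows "vec.span {x} = vec.span {y}"
proof -
  have "y \<in> vec.span {x}"
  proof (rule ccontr)
    assume "y \<notin> vec.span {x}"
    then have "T = L i"
      using proj_line_eq_span_pair[of _ x y] x T skew_linesD(1)[OF sk ij(1)]
      by (metis transversal_def)
    then show False
      using transversal_meet[OF sk T ij(2)] skew_lines_Int[OF sk ij] by metis
  qed
  with x show ?thesis
    by (subst span_singleton_eq_iff) (auto simp: vec.span_singleton)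
qed

text \<open>\<open>T\<close> is spanned by its points \<open>u\<close> on \<open>L j\<close> and
  \<open>v\<close> on \<open>L k\<close>. Expanding \<open>x\<close> in \<open>u\<close> and
  \<open>v\<close> decomposes it along these two lines, and uniqueness identifies the terms with
  \<open>y\<close> and \<open>z\<close>.\<close>

lemma transversal_decomp:
  assumes sk: "skew_lines s L" and T: "transversal s L T"
    and ijk: "i \<in> {1..s}" "j \<in> {1..s}" "k \<in> {1..s}" "i \<noteq> j" "j \<noteq> k" "i \<noteq> k"
    and x: "x \<in> T" "x \<in> L i" "x \<noteq> 0" "y \<in> L j" "z \<in> L k" "x = y + z"
  shows "y \<in> T" "z \<in> T"
proof -
  note sub = skew_linesD(2)[OF sk]
  obtain u where u: "u \<in> T" "u \<in> L j" "u \<noteq> 0"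
    using transversal_meet[OF sk T ijk(2)] .
  obtain v where v: "v \<in> T" "v \<in> L k" "v \<noteq> 0"
    using transversal_meet[OF sk T ijk(3)] .
  have "v \<notin> vec.span {u}"
  proof
    assume "v \<in> vec.span {u}"
    then have "v \<in> L j"
      using u sub[OF ijk(2)] by (auto simp: vec.span_singleton vec.subspace_scale)
    then show False
      using skew_lines_Int[OF sk ijk(2,3,5)] v by blast
  qed
  then have "T = vec.span {u, v}"
    using T u v proj_line_eq_span_pair by (auto simp: transversal_def)
  then obtain a b where ab: "x = a *s u + b *s v"
    using x by (auto simp: span_pair_iff)
  have Ts: "vec.subspace T"
    using T by (simp add: transversal_def proj_line_def)
  have "y + z = a *s u + b *s v"
    using ab x by simp
  then have "y = a *s u \<and> z = b *s v"
    using skew_lines_decomp_unique[OF sk ijk(2,3,5) x(4,5)] u v sub ijk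
    by (meson vec.subspace_scale)
  then show "y \<in> T" "z \<in> T"
    using u v Ts by (auto simp: vec.subspace_scale)
qed

text \<open>Supplies the third line that a generator needs; used with \<open>i = j\<close>, it
  supplies a second line.\<close>

lemma other_index:
  fixes i j s :: nat
  assumes "s \<ge> 3"
  obtains k where "k \<in> {1..s}" "k \<noteq> i" "k \<noteq> j"
proof -
  have "\<not> {1, 2, 3} \<subseteq> {i, j}"
    using card_mono[of "{i, j}" "{1, 2, 3::nat}"] card_insert_le_m1[of 2 "{j}" i] by auto
  then obtain k where "k \<in> {1, 2, 3}" "k \<notin> {i, j}"
    by blast
  with assms show ?thesis
    by (intro that[of k]) auto
qed

text \<open>For a generator, the summand of \<open>x\<close> on \<open>L j\<close> stays on
  \<open>T\<close> and hence represents the only point of \<open>T\<close> there; the identity case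
  is this uniqueness alone.\<close>

lemma arrow_transversal:
  assumes sk: "skew_lines s L" and s: "s \<ge> 3" and T: "transversal s L T"
    and "arrow s L i j g"
    and "x \<in> T" "x \<in> L i" "x \<noteq> 0" "y \<in> T" "y \<in> L j" "y \<noteq> 0"
  shows "g (vec.span {x}) = vec.span {y}"
  using assms(4-)
proof (induction arbitrary: x y)
  case (gen i j k)
  note ijk = gen.hyps
  obtain y' z where yz: "y' \<in> L j" "z \<in> L k" "x = y' + z"
    using skew_lines_decomp[OF sk ijk(2,3,5)] by blast
  have "line_map L i j k (vec.span {x}) = vec.span {y'}"
    using line_map_span[OF sk ijk _ _ yz] gen.prems by blast
  also have "\<dots> = vec.span {y}"
    using transversal_Int[OF sk T ijk(2,3,5), of y' y] yz gen.prems
      transversal_decomp[OF sk T ijk _ _ _ yz] skew_lines_decomp_nonzero[OF sk ijk _ _ yz]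
    by blast
  finally show ?case .
next
  case (ident i)
  then show ?case
    using other_index[OF s, of i i] transversal_Int[OF sk T, of i _ x y]
      span_in_points_of[OF skew_linesD(2)[OF sk]] by (metis restrict_apply')
next
  case (comp i j g k h)
  \<comment> \<open>A composite passes through the point of \<open>T\<close> on the middle
    line.\<close>
  obtain z where z: "z \<in> T" "z \<in> L j" "z \<noteq> 0"
    using transversal_meet[OF sk T arrow_PiE(2)[OF sk comp.hyps(1)]] .
  have "vec.span {x} \<in> points_of (L i)"
    using span_in_points_of[OF skew_linesD(2)[OF sk]] arrow_PiE(1)[OF sk comp.hyps(1)] comp.prems
    by blast
  then show ?case
    using comp.IH(1)[of x z] comp.IH(2)[of z y] z comp.prems by (simp add: compose_eq)
qed

text \<open>The candidate \<open>T\<close> is the line through \<open>p\<close> that meets two other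
  lines \<open>L j\<close> and \<open>L k\<close>. For each further line \<open>L l\<close>, a loop
  built from \<open>k\<close> and \<open>l\<close> must fix \<open>p\<close>, and this puts a point
  of \<open>L l\<close> on \<open>T\<close>.\<close>

lemma fixed_point_on_transversal:
  assumes sk: "skew_lines s L" and s: "s \<ge> 3" and i: "i \<in> {1..s}"
    and p: "p \<in> points_of (L i)" and fix_p: "\<And>g. arrow s L i i g \<Longrightarrow> g p = p"
  shows "\<exists>T. transversal s L T \<and> p \<in> points_of T"
proof -
  note sub = skew_linesD(2)[OF sk]
  obtain x where x: "x \<in> L i" "x \<noteq> 0" and px: "p = vec.span {x}"
    using p points_of_iff[OF sub[OF i]] by blast
  obtain j where j: "j \<in> {1..s}" "i \<noteq> j"
    using other_index[OF s, of i i] by metis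
  obtain k where k: "k \<in> {1..s}" "i \<noteq> k" "j \<noteq> k"
    using other_index[OF s, of i j] by metis
  obtain y z where yz: "y \<in> L j" "z \<in> L k" "x = y + z"
    using skew_lines_decomp[OF sk j(1) k(1,3)] by blast
  have nz: "y \<noteq> 0" "z \<noteq> 0"
    using skew_lines_decomp_nonzero[OF sk i j(1) k(1) j(2) k(3,2) x yz] .
  define T where "T = vec.span {y, z}"
  have "z \<notin> vec.span {y}"
  proof
    assume "z \<in> vec.span {y}"
    then have "z \<in> L j"
      using yz sub[OF j(1)] by (auto simp: vec.span_singleton vec.subspace_scale)
    then show False
      using skew_lines_Int[OF sk j(1) k(1,3)] nz yz by blast
  qed
  then have T: "proj_line T"
    using proj_line_span_pair nz unfolding T_def by blast
  have yT: "y \<in> T" and zT: "z \<in> T"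
    by (simp_all add: T_def vec.span_base)
  have xT: "x \<in> T"
    using yT zT yz by (simp add: T_def vec.span_add)
  have "\<exists>w. w \<in> T \<and> w \<in> L l \<and> w \<noteq> 0" if l: "l \<in> {1..s}" for l
  proof (cases "l = i \<or> l = j \<or> l = k")
    case True
    then show ?thesis
      using x yz nz xT yT zT by blast
  next
    case False
    then have ne: "i \<noteq> l" "j \<noteq> l" by auto
    obtain y' w where yw: "y' \<in> L j" "w \<in> L l" "x = y' + w"
      using skew_lines_decomp[OF sk j(1) l ne(2)] by blast
    have nz': "y' \<noteq> 0" "w \<noteq> 0"
      using skew_lines_decomp_nonzero[OF sk i j(1) l j(2) ne(2,1) x yw] .
    obtain x' z' where xz: "x' \<in> L i" "z' \<in> L k" "y' = x' + z'"
      using skew_lines_decomp[OF sk i k(1,2)] by blast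
    have nz'': "x' \<noteq> 0"
      using skew_lines_decomp_nonzero[OF sk j(1) i k(1) j(2)[symmetric] k(2,3) yw(1) nz'(1) xz]
      by blast
    \<comment> \<open>Go to \<open>L j\<close> using \<open>L l\<close> and return using
      \<open>L k\<close>. That this loop fixes \<open>p\<close> means that \<open>x'\<close> is a
      multiple of \<open>x\<close>.\<close>
    let ?g = "compose (points_of (L i)) (line_map L j i k) (line_map L i j l)"
    have "arrow s L i i ?g"
      using i j k l ne by (metis arrow.comp arrow.gen)
    then have "?g p = p"
      by (rule fix_p)
    moreover have "?g p = vec.span {x'}"
      using line_map_span[OF sk i j(1) l j(2) ne(2,1) x yw]
        line_map_span[OF sk j(1) i k(1) j(2)[symmetric] k(2,3) yw(1) nz'(1) xz] p
      by (simp add: compose_eq px)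
    ultimately obtain c where c: "x' = c *s x"
      using span_singleton_eq_iff[OF nz''] px by metis
    \<comment> \<open>Substituting \<open>c *s (y + z)\<close> for \<open>x'\<close> gives a second
      decomposition of \<open>y'\<close> along \<open>L j\<close> and \<open>L k\<close>. So
      \<open>y'\<close> is a multiple of \<open>y\<close>, and \<open>w = x - y'\<close> lies on
      \<open>T\<close>.\<close>
    have "y' + 0 = c *s y + (c *s z + z')"
      using c xz yz by (simp add: vec.scale_right_distrib)
    moreover have "0 \<in> L k" "c *s y \<in> L j" "c *s z + z' \<in> L k"
      using yz xz sub j k by (simp_all add: vec.subspace_0 vec.subspace_add vec.subspace_scale)
    ultimately have "y' = c *s y"
      using skew_lines_decomp_unique(1)[OF sk j(1) k(1,3) yw(1)] by blast
    then have "w = x - c *s y"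
      using yw by simp
    then have "w \<in> T"
      using xT yT T by (auto intro: vec.subspace_diff vec.subspace_scale simp: proj_line_def)
    with yw nz' show ?thesis by blast
  qed
  then have "transversal s L T"
    using T meets_iff[OF proj_line_subspace[OF T] sub] by (simp add: transversal_def)
  moreover have "p \<in> points_of T"
    using span_in_points_of[OF proj_line_subspace[OF T]] x xT px by blast
  ultimately show ?thesis by blast
qed

section \<open>Orbits and vertex groups\<close>

lemma line_orbit_transversal:
  assumes sk: "skew_lines s L" and s: "s \<ge> 3" and i: "i \<in> {1..s}"
    and p: "p \<in> points_of (L i)" and T: "transversal s L T" "p \<in> points_of T"
  shows "line_orbit s L i p = points_of T \<inter> (\<Union>j\<in>{1..s}. points_of (L j))"
proof -
  note sub = skew_linesD(2)[OF sk]
  have Ts: "vec.subspace T"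
    using T by (simp add: transversal_def proj_line_def)
  obtain x where x: "x \<in> L i" "x \<noteq> 0" and px: "p = vec.span {x}"
    using p points_of_iff[OF sub[OF i]] by blast
  have xT: "x \<in> T"
    using T x px span_in_points_of[OF Ts] by blast
  show ?thesis
  proof (intro equalityI subsetI)
    fix q assume "q \<in> line_orbit s L i p"
    then obtain j g where j: "j \<in> {1..s}" and g: "arrow s L i j g" and q: "q = g p"
      by (auto simp: line_orbit_def Hom_C_def)
    obtain y where y: "y \<in> T" "y \<in> L j" "y \<noteq> 0"
      using transversal_meet[OF sk T(1) j] .
    then have "q = vec.span {y}"
      using arrow_transversal[OF sk s T(1) g xT x] q px by simp
    then show "q \<in> points_of T \<inter> (\<Union>j\<in>{1..s}. points_of (L j))"
      using span_in_points_of[OF Ts] span_in_points_of[OF sub] y j by blast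
  next
    fix q assume "q \<in> points_of T \<inter> (\<Union>j\<in>{1..s}. points_of (L j))"
    then obtain j where j: "j \<in> {1..s}" and q: "q \<in> points_of T" "q \<in> points_of (L j)"
      by blast
    obtain y where y: "y \<in> L j" "y \<noteq> 0" and qy: "q = vec.span {y}"
      using q points_of_iff[OF sub[OF j]] by blast
    have yT: "y \<in> T"
      using q y qy span_in_points_of[OF Ts] by blast
    \<comment> \<open>Any arrow to \<open>L j\<close> will do, since
      \<open>arrow_transversal\<close> sends \<open>p\<close> to \<open>q\<close> along it: the
      identity, or a generator using a third line.\<close>
    have "\<exists>g. arrow s L i j g"
    proof (cases "i = j")
      case True
      with i show ?thesis by (blast intro: arrow.ident)
    next
      case False
      moreover obtain k where "k \<in> {1..s}" "k \<noteq> i" "k \<noteq> j"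
        using other_index[OF s] .
      ultimately show ?thesis
        using i j by (blast intro: arrow.gen)
    qed
    then obtain g where g: "arrow s L i j g" ..
    then have "g p = q"
      using arrow_transversal[OF sk s T(1) g xT x yT y] px qy by simp
    with g j show "q \<in> line_orbit s L i p"
      by (auto simp: line_orbit_def Hom_C_def)
  qed
qed

text \<open>A one-point orbit on \<open>L i\<close> says that every loop fixes \<open>p\<close>.
  Conversely, the orbit consists of points of \<open>T\<close>, and \<open>T\<close> has a single
  point on \<open>L i\<close>.\<close>

lemma line_orbit_on_singleton_iff:
  assumes sk: "skew_lines s L" and s: "s \<ge> 3" and i: "i \<in> {1..s}"
    and p: "p \<in> points_of (L i)"
  shows "line_orbit_on s L i p i = {p} \<longleftrightarrow> (\<exists>T. transversal s L T \<and> p \<in> points_of T)"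
proof
  assume orb: "line_orbit_on s L i p i = {p}"
  have "g p = p" if "arrow s L i i g" for g
  proof -
    have "g p \<in> line_orbit_on s L i p i"
      using that arrow_PiE(3)[OF sk that] p i
      by (auto simp: line_orbit_on_def line_orbit_def Hom_C_def PiE_iff)
    with orb show ?thesis by simp
  qed
  then show "\<exists>T. transversal s L T \<and> p \<in> points_of T"
    using fixed_point_on_transversal[OF sk s i p] by blast
next
  note sub = skew_linesD(2)[OF sk i]
  assume "\<exists>T. transversal s L T \<and> p \<in> points_of T"
  then obtain T where T: "transversal s L T" "p \<in> points_of T"
    by blast
  obtain j where j: "j \<in> {1..s}" "i \<noteq> j"
    using other_index[OF s, of i i] by metis
  have Ts: "vec.subspace T"
    using T by (simp add: transversal_def proj_line_def)
  have "q = p" if q: "q \<in> points_of T" "q \<in> points_of (L i)" for q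
  proof -
    obtain x where x: "x \<in> L i" "x \<noteq> 0" "p = vec.span {x}"
      using p points_of_iff[OF sub] by blast
    obtain y where y: "y \<in> L i" "y \<noteq> 0" "q = vec.span {y}"
      using q points_of_iff[OF sub] by blast
    have "x \<in> T" "y \<in> T"
      using x y q T span_in_points_of[OF Ts] by blast+
    then show ?thesis
      using x y transversal_Int[OF sk T(1) i j, of x y] by blast
  qed
  then show "line_orbit_on s L i p i = {p}"
    unfolding line_orbit_on_def line_orbit_transversal[OF sk s i p T] using p T(2) i by blast
qed

text \<open>The identity is always an arrow, so both sides say that every loop fixes every point of
  \<open>L i\<close>; extensionality turns this pointwise statement into equality with the
  identity.\<close>

lemma card_vertex_group_eq_1_iff:
  assumes sk: "skew_lines s L" and s: "s \<ge> 3" and i: "i \<in> {1..s}"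
  shows "card (vertex_group s L i) = 1 \<longleftrightarrow>
    (\<forall>p\<in>points_of (L i). \<exists>T. transversal s L T \<and> p \<in> points_of T)"
proof
  let ?id = "\<lambda>p\<in>points_of (L i). p"
  have id: "?id \<in> vertex_group s L i"
    using i by (auto simp: vertex_group_def Hom_C_def intro: arrow.ident)
  {
    assume "card (vertex_group s L i) = 1"
    then have "vertex_group s L i = {?id}"
      using id by (auto simp: card_1_singleton_iff)
    then have "g = ?id" if "arrow s L i i g" for g
      using that by (simp add: vertex_group_def Hom_C_def set_eq_iff)
    then have "g p = p" if "p \<in> points_of (L i)" "arrow s L i i g" for g p
      using that by (metis restrict_apply')
    then show "\<forall>p\<in>points_of (L i). \<exists>T. transversal s L T \<and> p \<in> points_of T"
      using fixed_point_on_transversal[OF sk s i] by blast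
  next
    assume *: "\<forall>p\<in>points_of (L i). \<exists>T. transversal s L T \<and> p \<in> points_of T"
    have "g = ?id" if g: "arrow s L i i g" for g
    proof (rule extensionalityI)
      show "g \<in> extensional (points_of (L i))"
        using arrow_PiE(3)[OF sk g] by (simp add: PiE_iff)
      fix p assume p: "p \<in> points_of (L i)"
      have "g p \<in> line_orbit_on s L i p i"
        using g arrow_PiE(3)[OF sk g] p i
        by (auto simp: line_orbit_on_def line_orbit_def Hom_C_def PiE_iff)
      with line_orbit_on_singleton_iff[OF sk s i p] * p show "g p = ?id p"
        by auto
    qed simp
    then have "vertex_group s L i = {?id}"
      using id unfolding vertex_group_def Hom_C_def by blast
    then show "card (vertex_group s L i) = 1"
      by simp
  }
qed

section \<open>Quadrics\<close>

text \<open>The polar form \<open>q(x + y) - q(x) - q(y)\<close> of \<open>q = quad_form A\<close>,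
  see \<open>quad_form_add\<close>. Written as the gradient at \<open>x\<close> applied to
  \<open>y\<close>, it is correct in characteristic 2 and ties in with the Jacobian criterion; at a
  smooth point \<open>x\<close> its zeros form the tangent plane.\<close>

definition quad_polar :: "'a::field ^ 4 ^ 4 \<Rightarrow> 'a ^ 4 \<Rightarrow> 'a ^ 4 \<Rightarrow> 'a" where
  "quad_polar A x y = (\<Sum>k\<in>UNIV. quad_partial A k x * y $ k)"

lemma quad_polar_commute: "quad_polar A x y = quad_polar A y x"
  by (simp add: quad_polar_def quad_partial_def sum_4 algebra_simps)

lemma quad_polar_add_right: "quad_polar A x (y + z) = quad_polar A x y + quad_polar A x z"
  by (simp add: quad_polar_def sum_4 algebra_simps)

lemma quad_polar_scale_right: "quad_polar A x (c *s y) = c * quad_polar A x y"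
  by (simp add: quad_polar_def sum_4 algebra_simps)

lemma quad_polar_diff_right: "quad_polar A x (y - z) = quad_polar A x y - quad_polar A x z"
  by (simp add: quad_polar_def sum_4 algebra_simps)

lemma quad_form_zero [simp]: "quad_form A 0 = 0"
  by (simp add: quad_form_def)

lemma quad_form_add: "quad_form A (x + y) = quad_form A x + quad_form A y + quad_polar A x y"
  by (simp add: quad_form_def quad_polar_def quad_partial_def sum_4 algebra_simps)

text \<open>The embedding \<open>to_ac\<close> is an injective homomorphism, so \<open>x\<close>
  gives a nonzero zero of the form over the closure, and the Jacobian criterion yields a nonzero
  partial derivative. Pairing with a unit vector picks it out.\<close>

lemma smooth_quadric_polar_nonzero:
  fixes A :: "'a::field ^ 4 ^ 4"
  assumes "smooth_quadric A" "x \<noteq> 0" "quad_form A x = 0"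
  shows "\<exists>y. quad_polar A x y \<noteq> 0"
proof -
  define A' where "A' = (\<chi> i j. to_ac (A $ i $ j))"
  define x' where "x' = (\<chi> i. to_ac (x $ i))"
  have "\<not> (x' \<noteq> 0 \<and> quad_form A' x' = 0 \<and> (\<forall>k. quad_partial A' k x' = 0))"
    using assms(1) unfolding smooth_quadric_def Let_def A'_def[symmetric] by blast
  moreover have "x' \<noteq> 0"
    using assms(2) by (auto simp: x'_def vec_eq_iff)
  moreover have "quad_form A' x' = to_ac (quad_form A x)"
    by (simp add: quad_form_def A'_def x'_def to_ac_sum)
  moreover have "quad_partial A' k x' = to_ac (quad_partial A k x)" for k
    by (simp add: quad_partial_def A'_def x'_def to_ac_sum)
  ultimately obtain k where k: "quad_partial A k x \<noteq> 0"
    using assms(3) by auto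
  have "quad_polar A x (axis k 1) = quad_partial A k x"
    by (simp add: quad_polar_def axis_def if_distrib cong: if_cong)
  with k show ?thesis by metis
qed

section \<open>A smooth form: a difference of products of linear forms\<close>

lemma quad_form_prod_diff:
  fixes B :: "'a::field ^ 4 ^ 4"
  shows "quad_form (\<chi> r c. B $ 1 $ r * B $ 4 $ c - B $ 2 $ r * B $ 3 $ c) x =
    (B *v x) $ 1 * (B *v x) $ 4 - (B *v x) $ 2 * (B *v x) $ 3"
  by (simp add: quad_form_def matrix_vector_mult_def sum_4 algebra_simps)

text \<open>Product rule for \<open>b1 * b4 - b2 * b3\<close>, where \<open>b1\<close> to
  \<open>b4\<close> are the linear forms given by the rows of \<open>B\<close>.\<close>

lemma quad_partial_prod_diff:
  fixes B :: "'a::field ^ 4 ^ 4"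
  shows "quad_partial (\<chi> r c. B $ 1 $ r * B $ 4 $ c - B $ 2 $ r * B $ 3 $ c) k x =
    B $ 1 $ k * (B *v x) $ 4 + B $ 4 $ k * (B *v x) $ 1
    - B $ 2 $ k * (B *v x) $ 3 - B $ 3 $ k * (B *v x) $ 2"
  by (simp add: quad_partial_def matrix_vector_mult_def sum_4 algebra_simps)

text \<open>In the coordinates \<open>c = B *v x\<close> the form is
  \<open>c1 * c4 - c2 * c3\<close>, whose gradient \<open>(c4, -c3, -c2, c1)\<close> vanishes only
  at \<open>0\<close> in every characteristic. Invertibility of \<open>B\<close> persists over the
  algebraic closure.\<close>

lemma smooth_quadric_prod_diff:
  fixes B C :: "'a::field ^ 4 ^ 4"
  assumes BC: "B ** C = mat 1"
  shows "smooth_quadric (\<chi> r c. B $ 1 $ r * B $ 4 $ c - B $ 2 $ r * B $ 3 $ c)"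
proof -
  define B' where "B' = (\<chi> i j. to_ac (B $ i $ j))"
  define C' where "C' = (\<chi> i j. to_ac (C $ i $ j))"
  have "(B' ** C') $ i $ j = to_ac ((B ** C) $ i $ j)" for i j
    by (simp add: B'_def C'_def matrix_matrix_mult_def to_ac_sum)
  then have BC': "B' ** C' = mat 1"
    by (simp add: BC vec_eq_iff mat_def)
  then have CB': "C' ** B' = mat 1"
    by (simp add: matrix_left_right_inverse)
  define A' where "A' = (\<chi> r c. B' $ 1 $ r * B' $ 4 $ c - B' $ 2 $ r * B' $ 3 $ c)"
  have A': "(\<chi> i j. to_ac ((\<chi> r c. B $ 1 $ r * B $ 4 $ c - B $ 2 $ r * B $ 3 $ c) $ i $ j)) = A'"
    by (simp add: A'_def B'_def vec_eq_iff)
  have "x = 0" if *: "\<And>k. quad_partial A' k x = 0" for x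
  proof -
    define c where "c = B' *v x"
    \<comment> \<open>Chain rule: pairing the gradient with column \<open>m\<close> of
      \<open>C'\<close> gives the partial derivative in the coordinate \<open>c $ m\<close>.\<close>
    have "(\<Sum>k\<in>UNIV. quad_partial A' k x * C' $ k $ m) =
      (B' ** C') $ 1 $ m * c $ 4 + (B' ** C') $ 4 $ m * c $ 1
      - (B' ** C') $ 2 $ m * c $ 3 - (B' ** C') $ 3 $ m * c $ 2" for m
      by (simp add: A'_def quad_partial_prod_diff c_def[symmetric] matrix_matrix_mult_def sum_4
          algebra_simps)
    then have m: "(mat 1 :: 'a alg_closure ^ 4 ^ 4) $ 1 $ m * c $ 4
      + (mat 1 :: 'a alg_closure ^ 4 ^ 4) $ 4 $ m * c $ 1
      - (mat 1 :: 'a alg_closure ^ 4 ^ 4) $ 2 $ m * c $ 3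
      - (mat 1 :: 'a alg_closure ^ 4 ^ 4) $ 3 $ m * c $ 2 = 0" for m
      by (simp add: BC' *)
    have "c = 0"
      using m[of 1] m[of 2] m[of 3] m[of 4] by (simp add: mat_def vec_eq_iff forall_4)
    moreover have "C' *v c = x"
      by (simp add: c_def matrix_vector_mul_assoc CB')
    ultimately show ?thesis
      by simp
  qed
  then show ?thesis
    unfolding smooth_quadric_def Let_def A' by blast
qed

section \<open>Lines on a quadric and tangent planes\<close>

lemma quadric_points_line_iff:
  assumes "vec.subspace M"
  shows "points_of M \<subseteq> quadric_points A \<longleftrightarrow> (\<forall>x\<in>M. quad_form A x = 0)"
proof
  assume M: "points_of M \<subseteq> quadric_points A"
  show "\<forall>x\<in>M. quad_form A x = 0"
  proof
    fix x assume x: "x \<in> M"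
    show "quad_form A x = 0"
    proof (cases "x = 0")
      case False
      with x M have "vec.span {x} \<in> quadric_points A"
        using span_in_points_of[OF assms] by blast
      then show ?thesis
        by (simp add: quadric_points_def vec.span_base)
    qed simp
  qed
qed (auto simp: points_of_def quadric_points_def)

text \<open>A linear functional that is nonzero on the 2-dimensional space \<open>M\<close> has a
  kernel of dimension 1 there.\<close>

lemma quad_polar_kernel_on_line:
  assumes M: "proj_line M"
    and x: "x \<in> M" "x \<noteq> 0" "quad_polar A v x = 0"
    and y: "y \<in> M" "quad_polar A v y = 0"
    and u: "u \<in> M" "quad_polar A v u \<noteq> 0"
  shows "y \<in> vec.span {x}"
proof (rule ccontr)
  assume "y \<notin> vec.span {x}"
  then have "M = vec.span {x, y}"
    using proj_line_eq_span_pair M x y by blast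
  with u obtain a b where "u = a *s x + b *s y"
    by (auto simp: span_pair_iff)
  with u x y show False
    by (simp add: quad_polar_add_right quad_polar_scale_right)
qed

text \<open>The tangent plane at \<open>x\<close> contains \<open>L i\<close> and has a point on
  each other line. \<open>T\<close> joins \<open>x\<close> to such a point \<open>w\<close> on
  \<open>L j\<close>, and the points found on the other lines turn out to lie on
  \<open>T\<close>.\<close>

lemma smooth_quadric_transversal:
  assumes sk: "skew_lines s L" and i: "i \<in> {1..s}"
    and A: "smooth_quadric A" and L: "\<And>j. j \<in> {1..s} \<Longrightarrow> points_of (L j) \<subseteq> quadric_points A"
    and j: "j \<in> {1..s}" "i \<noteq> j" and p: "p \<in> points_of (L i)"
  shows "\<exists>T. transversal s L T \<and> p \<in> points_of T"
proof -
  note sub = skew_linesD(2)[OF sk]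
  obtain x where x: "x \<in> L i" "x \<noteq> 0" and px: "p = vec.span {x}"
    using p points_of_iff[OF sub[OF i]] by blast
  have Q0: "quad_form A y = 0" if "y \<in> L k" "k \<in> {1..s}" for y k
    using L[OF that(2)] that quadric_points_line_iff[OF sub] by blast
  have B0: "quad_polar A y z = 0" if "y \<in> L k" "z \<in> L k" "k \<in> {1..s}" for y z k
    using Q0[of "y + z" k] Q0[of y k] Q0[of z k] that sub
    by (simp add: quad_form_add vec.subspace_add)
  \<comment> \<open>The space is the sum of \<open>L k\<close> and \<open>L l\<close>, and
    \<open>quad_polar A y\<close> vanishes on \<open>L k\<close>, so a nonzero value must occur on
    \<open>L l\<close>.\<close>
  have nondeg: "\<exists>z\<in>L l. quad_polar A y z \<noteq> 0"
    if y: "y \<in> L k" "y \<noteq> 0" and kl: "k \<in> {1..s}" "l \<in> {1..s}" "k \<noteq> l" for y k l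
  proof -
    obtain v where v: "quad_polar A y v \<noteq> 0"
      using smooth_quadric_polar_nonzero[OF A] y Q0 kl by blast
    obtain a b where "a \<in> L k" "b \<in> L l" "v = a + b"
      using skew_lines_decomp[OF sk kl] by blast
    then show ?thesis
      using v B0 y kl by (auto simp: quad_polar_add_right)
  qed
  have kernel: "\<exists>w\<in>L k. w \<noteq> 0 \<and> quad_polar A x w = 0" if k: "k \<in> {1..s}" "i \<noteq> k" for k
  proof -
    obtain y where y: "y \<in> L k" "quad_polar A x y \<noteq> 0"
      using nondeg[OF x i k] by blast
    then have "y \<noteq> 0"
      using quad_polar_scale_right[of A x 0 y] by auto
    then obtain f where f: "f \<in> L k" "f \<notin> vec.span {y}"
      using proj_line_basis[OF skew_linesD(1)[OF sk k(1)] y(1)] by blast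
    \<comment> \<open>This \<open>c\<close> moves \<open>f\<close> along \<open>y\<close> into the
      kernel of \<open>quad_polar A x\<close>; independence of \<open>f\<close> and \<open>y\<close>
      keeps the result nonzero.\<close>
    define c where "c = quad_polar A x f / quad_polar A x y"
    have "quad_polar A x (f - c *s y) = 0"
      using y by (simp add: c_def quad_polar_diff_right quad_polar_scale_right)
    moreover have "f - c *s y \<noteq> 0"
      using f by (auto simp: vec.span_singleton)
    moreover have "f - c *s y \<in> L k"
      using f y sub[OF k(1)] by (simp add: vec.subspace_diff vec.subspace_scale)
    ultimately show ?thesis by blast
  qed
  obtain w where w: "w \<in> L j" "w \<noteq> 0" "quad_polar A x w = 0"
    using kernel[OF j] by blast
  define T where "T = vec.span {x, w}"
  have "w \<notin> vec.span {x}"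
  proof
    assume "w \<in> vec.span {x}"
    then have "w \<in> L i"
      using x sub[OF i] by (auto simp: vec.span_singleton vec.subspace_scale)
    then show False
      using skew_lines_Int[OF sk i j] w by blast
  qed
  then have T: "proj_line T"
    using proj_line_span_pair x unfolding T_def by blast
  have xT: "x \<in> T" and wT: "w \<in> T"
    by (simp_all add: T_def vec.span_base)
  \<comment> \<open>Write \<open>v \<in> L k\<close>, orthogonal to \<open>x\<close>, as \<open>l + t *s w\<close>.  Vanishing of the form at \<open>v\<close> makes
    \<open>l \<in> L i\<close> orthogonal to \<open>w\<close>, hence a multiple of \<open>x\<close>.\<close>
  have "\<exists>v. v \<in> T \<and> v \<in> L k \<and> v \<noteq> 0" if k: "k \<in> {1..s}" for k
  proof (cases "k = i")
    case True
    with x xT show ?thesis by blast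
  next
    case False
    then obtain v where v: "v \<in> L k" "v \<noteq> 0" "quad_polar A x v = 0"
      using kernel[OF k] by blast
    obtain l m where lm: "l \<in> L i" "m \<in> L j" "v = l + m"
      using skew_lines_decomp[OF sk i j] by blast
    have "quad_polar A x m = 0"
      using v lm B0[OF x(1) lm(1) i] by (simp add: quad_polar_add_right)
    then have "m \<in> vec.span {w}"
      using quad_polar_kernel_on_line[OF skew_linesD(1)[OF sk j(1)] w lm(2)] nondeg[OF x i j]
      by blast
    then obtain t where t: "m = t *s w"
      by (auto simp: vec.span_singleton)
    have "t \<noteq> 0"
    proof
      assume "t = 0"
      then have "v \<in> L i"
        using lm t by simp
      then show False
        using skew_lines_Int[OF sk i k] False v by blast
    qed
    moreover have "quad_form A v = t * quad_polar A l w"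
      using Q0[OF lm(1) i] Q0[OF lm(2) j(1)] lm(3) t
      by (simp add: quad_form_add quad_polar_scale_right)
    ultimately have "quad_polar A w l = 0"
      using Q0[OF v(1) k] by (simp add: quad_polar_commute[of A w])
    moreover have "quad_polar A w x = 0"
      using w(3) by (simp add: quad_polar_commute[of A w])
    ultimately have "l \<in> vec.span {x}"
      using quad_polar_kernel_on_line[OF skew_linesD(1)[OF sk i] x] lm(1)
        nondeg[OF w(1,2) j(1) i j(2)[symmetric]] by blast
    then obtain c where "l = c *s x"
      by (auto simp: vec.span_singleton)
    then have "v \<in> T"
      using lm t by (auto simp: T_def span_pair_iff)
    with v show ?thesis by blast
  qed
  then have "transversal s L T"
    using T meets_iff[OF proj_line_subspace[OF T] sub] by (simp add: transversal_def)
  moreover have "p \<in> points_of T"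
    using span_in_points_of[OF proj_line_subspace[OF T]] x xT px by blast
  ultimately show ?thesis by blast
qed

text \<open>The basis consists of \<open>e1\<close>, \<open>e2\<close> on \<open>L i\<close> and
  their projections \<open>f1\<close>, \<open>f2\<close> to \<open>L j\<close> along
  \<open>L k\<close>. A transversal through a point of \<open>L i\<close> joins vectors with equal
  coordinates on the two lines, so the determinant \<open>a1 * b2 - a2 * b1\<close> vanishes on
  it.\<close>

lemma transversals_imp_smooth_quadric:
  fixes L :: "nat \<Rightarrow> ('a::field ^ 4) set"
  assumes sk: "skew_lines s L" and s: "s \<ge> 3" and i: "i \<in> {1..s}"
    and tr: "\<And>p. p \<in> points_of (L i) \<Longrightarrow> \<exists>T. transversal s L T \<and> p \<in> points_of T"
  shows "\<exists>A. smooth_quadric A \<and> (\<forall>j\<in>{1..s}. points_of (L j) \<subseteq> quadric_points A)"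
proof -
  note sub = skew_linesD(2)[OF sk]
  obtain j where j: "j \<in> {1..s}" "i \<noteq> j"
    using other_index[OF s, of i i] by metis
  obtain k where k: "k \<in> {1..s}" "i \<noteq> k" "j \<noteq> k"
    using other_index[OF s, of i j] by metis
  obtain e1 where e1: "e1 \<in> L i" "e1 \<noteq> 0"
    using proj_line_nonzero[OF skew_linesD(1)[OF sk i]] .
  obtain e2 where e2: "e2 \<in> L i" "e2 \<notin> vec.span {e1}" and Li: "L i = vec.span {e1, e2}"
    using proj_line_basis[OF skew_linesD(1)[OF sk i] e1] .
  obtain f1 g1 where fg1: "f1 \<in> L j" "g1 \<in> L k" "e1 = f1 + g1"
    using skew_lines_decomp[OF sk j(1) k(1,3)] by blast
  obtain f2 g2 where fg2: "f2 \<in> L j" "g2 \<in> L k" "e2 = f2 + g2"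
    using skew_lines_decomp[OF sk j(1) k(1,3)] by blast
  have f1: "f1 \<noteq> 0"
    using skew_lines_decomp_nonzero[OF sk i j(1) k(1) j(2) k(3,2) e1 fg1] by blast
  \<comment> \<open>If the projections were proportional, a nonzero vector
    \<open>e2 - c *s e1\<close> of \<open>L i\<close> would lie on \<open>L k\<close>.\<close>
  have "f2 \<notin> vec.span {f1}"
  proof
    assume "f2 \<in> vec.span {f1}"
    then obtain c where "f2 = c *s f1"
      by (auto simp: vec.span_singleton)
    then have "e2 - c *s e1 = g2 - c *s g1"
      using fg1 fg2 by (simp add: vec.scale_right_distrib)
    moreover have "e2 - c *s e1 \<in> L i" "g2 - c *s g1 \<in> L k"
      using e1 e2 fg1 fg2 sub i k by (simp_all add: vec.subspace_diff vec.subspace_scale)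
    ultimately have "e2 - c *s e1 = 0"
      using skew_lines_Int[OF sk i k(1,2)] by metis
    then show False
      using e2 by (auto simp: vec.span_singleton)
  qed
  then have Lj: "L j = vec.span {f1, f2}"
    using proj_line_eq_span_pair[OF skew_linesD(1)[OF sk j(1)]] fg1 fg2 f1 by blast

  \<comment> \<open>The columns of \<open>C\<close> are the basis vectors, so its inverse
    \<open>B\<close> reads off coordinates.\<close>
  define C :: "'a ^ 4 ^ 4" where
    "C = (\<chi> r c. (if c = 1 then e1 else if c = 2 then e2 else if c = 3 then f1 else f2) $ r)"
  have Cv: "C *v v = v $ 1 *s e1 + v $ 2 *s e2 + v $ 3 *s f1 + v $ 4 *s f2" for v
    by (simp add: C_def matrix_vector_mult_def vec_eq_iff sum_4 algebra_simps)
  have "\<exists>u. v = C *v u" for v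
  proof -
    obtain a b where "a \<in> L i" "b \<in> L j" and v: "v = a + b"
      using skew_lines_decomp[OF sk i j] by blast
    then obtain a1 a2 b1 b2 where "a = a1 *s e1 + a2 *s e2" "b = b1 *s f1 + b2 *s f2"
      by (auto simp: Li Lj span_pair_iff)
    then have "v = C *v (\<chi> i. if i = 1 then a1 else if i = 2 then a2 else if i = 3 then b1 else b2)"
      by (simp add: Cv v add.assoc)
    then show ?thesis ..
  qed
  then obtain B where CB: "C ** B = mat 1"
    by (metis matrix_right_invertible_surjective surj_def)
  then have BC: "B ** C = mat 1"
    by (simp add: matrix_left_right_inverse)
  have coords: "(B *v (a1 *s e1 + a2 *s e2 + b1 *s f1 + b2 *s f2)) $ 1 = a1"
    "(B *v (a1 *s e1 + a2 *s e2 + b1 *s f1 + b2 *s f2)) $ 2 = a2"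
    "(B *v (a1 *s e1 + a2 *s e2 + b1 *s f1 + b2 *s f2)) $ 3 = b1"
    "(B *v (a1 *s e1 + a2 *s e2 + b1 *s f1 + b2 *s f2)) $ 4 = b2" for a1 a2 b1 b2
  proof -
    define u :: "'a ^ 4" where "u = (\<chi> i. if i = 1 then a1 else if i = 2 then a2 else if i = 3 then b1 else b2)"
    have "a1 *s e1 + a2 *s e2 + b1 *s f1 + b2 *s f2 = C *v u"
      by (simp add: Cv u_def)
    then have "B *v (a1 *s e1 + a2 *s e2 + b1 *s f1 + b2 *s f2) = u"
      by (simp add: matrix_vector_mul_assoc BC)
    then show "(B *v (a1 *s e1 + a2 *s e2 + b1 *s f1 + b2 *s f2)) $ 1 = a1"
      "(B *v (a1 *s e1 + a2 *s e2 + b1 *s f1 + b2 *s f2)) $ 2 = a2"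
      "(B *v (a1 *s e1 + a2 *s e2 + b1 *s f1 + b2 *s f2)) $ 3 = b1"
      "(B *v (a1 *s e1 + a2 *s e2 + b1 *s f1 + b2 *s f2)) $ 4 = b2"
      by (simp_all add: u_def)
  qed
  have coords_eq: "a1 = a1' \<and> a2 = a2' \<and> b1 = b1' \<and> b2 = b2'"
    if "a1 *s e1 + a2 *s e2 + b1 *s f1 + b2 *s f2 = a1' *s e1 + a2' *s e2 + b1' *s f1 + b2' *s f2"
    for a1 a2 b1 b2 a1' a2' b1' b2'
    using that coords by metis

  define A where "A = (\<chi> r c. B $ 1 $ r * B $ 4 $ c - B $ 2 $ r * B $ 3 $ c)"
  have QA: "quad_form A (a1 *s e1 + a2 *s e2 + b1 *s f1 + b2 *s f2) = a1 * b2 - a2 * b1"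
    for a1 a2 b1 b2
    by (simp only: A_def quad_form_prod_diff coords)

  \<comment> \<open>A transversal through \<open>e\<close> contains the projection \<open>f\<close>,
    hence is the span of \<open>e\<close> and \<open>f\<close>; its point on \<open>L l\<close> is
    such a combination.\<close>
  have meet: "\<exists>\<alpha> \<beta>. \<alpha> *s e + \<beta> *s f \<in> L l \<and> \<alpha> *s e + \<beta> *s f \<noteq> 0"
    if e: "e \<in> L i" "e \<noteq> 0" and fg: "f \<in> L j" "g \<in> L k" "e = f + g" and l: "l \<in> {1..s}"
    for e f g l
  proof -
    have "vec.span {e} \<in> points_of (L i)"
      using e span_in_points_of[OF sub[OF i]] by blast
    then obtain T where T: "transversal s L T" "vec.span {e} \<in> points_of T"
      using tr by blast
    then have Tl: "proj_line T"
      by (simp add: transversal_def)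
    have eT: "e \<in> T"
      using T(2) e span_in_points_of[OF proj_line_subspace[OF Tl]] by blast
    have fT: "f \<in> T"
      using transversal_decomp(1)[OF sk T(1) i j(1) k(1) j(2) k(3,2) eT e fg] .
    have f: "f \<noteq> 0"
      using skew_lines_decomp_nonzero[OF sk i j(1) k(1) j(2) k(3,2) e fg] by blast
    have "f \<notin> vec.span {e}"
    proof
      assume "f \<in> vec.span {e}"
      then have "f \<in> L i"
        using e sub[OF i] by (auto simp: vec.span_singleton vec.subspace_scale)
      then show False
        using skew_lines_Int[OF sk i j] f fg by blast
    qed
    then have "T = vec.span {e, f}"
      using proj_line_eq_span_pair[OF Tl eT fT e(2)] by blast
    moreover obtain y where "y \<in> T" "y \<in> L l" "y \<noteq> 0"
      using transversal_meet[OF sk T(1) l] .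
    ultimately show ?thesis
      by (auto simp: span_pair_iff)
  qed

  \<comment> \<open>The transversals through \<open>e1\<close>, \<open>e2\<close> and \<open>e1 + e2\<close> suffice, which also covers the field with
    two elements.\<close>
  have "quad_form A v = 0" if l: "l \<in> {1..s}" and v: "v \<in> L l" for l v
  proof -
    have e2': "e2 \<noteq> 0"
      using e2 vec.span_zero by blast
    have e3: "e1 + e2 \<in> L i" "f1 + f2 \<in> L j" "g1 + g2 \<in> L k"
      "e1 + e2 = f1 + f2 + (g1 + g2)"
      using e1 e2 fg1 fg2 sub i j k by (simp_all add: vec.subspace_add)
    have e3': "e1 + e2 \<noteq> 0"
    proof
      assume "e1 + e2 = 0"
      then have "e2 = - e1"
        by (simp add: eq_neg_iff_add_eq_0 add.commute)
      then show False
        using e2 by (simp add: vec.span_neg vec.span_base)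
    qed
    obtain \<alpha>1 \<beta>1 where y1: "\<alpha>1 *s e1 + \<beta>1 *s f1 \<in> L l" "\<alpha>1 *s e1 + \<beta>1 *s f1 \<noteq> 0"
      using meet[OF e1 fg1 l] by blast
    obtain \<alpha>2 \<beta>2 where y2: "\<alpha>2 *s e2 + \<beta>2 *s f2 \<in> L l" "\<alpha>2 *s e2 + \<beta>2 *s f2 \<noteq> 0"
      using meet[OF e2(1) e2' fg2 l] by blast
    obtain \<alpha>3 \<beta>3 where y3: "\<alpha>3 *s (e1 + e2) + \<beta>3 *s (f1 + f2) \<in> L l"
        "\<alpha>3 *s (e1 + e2) + \<beta>3 *s (f1 + f2) \<noteq> 0"
      using meet[OF e3(1) e3' e3(2-4) l] by blast
    \<comment> \<open>The first two points of \<open>L l\<close> involve disjoint sets of basis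
      vectors, so they are independent and span \<open>L l\<close>; the third point is then a
      combination of them.\<close>
    have "\<alpha>2 *s e2 + \<beta>2 *s f2 \<notin> vec.span {\<alpha>1 *s e1 + \<beta>1 *s f1}"
    proof
      assume "\<alpha>2 *s e2 + \<beta>2 *s f2 \<in> vec.span {\<alpha>1 *s e1 + \<beta>1 *s f1}"
      then obtain c where "\<alpha>2 *s e2 + \<beta>2 *s f2 = c *s (\<alpha>1 *s e1 + \<beta>1 *s f1)"
        by (auto simp: vec.span_singleton)
      then have "0 *s e1 + \<alpha>2 *s e2 + 0 *s f1 + \<beta>2 *s f2
          = (c * \<alpha>1) *s e1 + 0 *s e2 + (c * \<beta>1) *s f1 + 0 *s f2"
        by (simp add: vec.scale_right_distrib)
      then have "\<alpha>2 = 0" "\<beta>2 = 0"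
        using coords_eq by blast+
      with y2 show False by simp
    qed
    then have Ll: "L l = vec.span {\<alpha>1 *s e1 + \<beta>1 *s f1, \<alpha>2 *s e2 + \<beta>2 *s f2}"
      using proj_line_eq_span_pair[OF skew_linesD(1)[OF sk l] y1(1) y2(1) y1(2)] by blast
    obtain c1 c2 where "\<alpha>3 *s (e1 + e2) + \<beta>3 *s (f1 + f2) =
        c1 *s (\<alpha>1 *s e1 + \<beta>1 *s f1) + c2 *s (\<alpha>2 *s e2 + \<beta>2 *s f2)"
      using y3(1) unfolding Ll span_pair_iff by blast
    then have "\<alpha>3 *s e1 + \<alpha>3 *s e2 + \<beta>3 *s f1 + \<beta>3 *s f2 =
        (c1 * \<alpha>1) *s e1 + (c2 * \<alpha>2) *s e2 + (c1 * \<beta>1) *s f1 + (c2 * \<beta>2) *s f2"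
      by (simp add: vec.scale_right_distrib algebra_simps)
    then have c: "\<alpha>3 = c1 * \<alpha>1" "\<alpha>3 = c2 * \<alpha>2" "\<beta>3 = c1 * \<beta>1" "\<beta>3 = c2 * \<beta>2"
      using coords_eq by blast+
    have nz: "\<alpha>3 \<noteq> 0 \<or> \<beta>3 \<noteq> 0"
      using y3(2) by auto
    have "c1 \<noteq> 0"
      using nz c(1,3) by auto
    moreover have "c2 \<noteq> 0"
      using nz c(2,4) by auto
    \<comment> \<open>Both sides equal \<open>\<alpha>3 * \<beta>3\<close>, and \<open>c1\<close>,
      \<open>c2\<close> can be cancelled.\<close>
    moreover have "(c1 * \<alpha>1) * (c2 * \<beta>2) = (c2 * \<alpha>2) * (c1 * \<beta>1)"
      using c by metis
    ultimately have det: "\<alpha>1 * \<beta>2 = \<alpha>2 * \<beta>1"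
      by simp
    obtain a b where "v = a *s (\<alpha>1 *s e1 + \<beta>1 *s f1) + b *s (\<alpha>2 *s e2 + \<beta>2 *s f2)"
      using v unfolding Ll span_pair_iff by blast
    then have "v = (a * \<alpha>1) *s e1 + (b * \<alpha>2) *s e2 + (a * \<beta>1) *s f1 + (b * \<beta>2) *s f2"
      by (simp add: vec.scale_right_distrib algebra_simps)
    then have "quad_form A v = (a * \<alpha>1) * (b * \<beta>2) - (b * \<alpha>2) * (a * \<beta>1)"
      by (simp only: QA)
    also have "\<dots> = a * b * (\<alpha>1 * \<beta>2 - \<alpha>2 * \<beta>1)"
      by (simp add: algebra_simps)
    finally show ?thesis
      using det by simp
  qed
  then have "\<forall>l\<in>{1..s}. points_of (L l) \<subseteq> quadric_points A"
    using quadric_points_line_iff[OF sub] by blast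
  moreover have "smooth_quadric A"
    unfolding A_def using BC by (rule smooth_quadric_prod_diff)
  ultimately show ?thesis by blast
qed

text \<open>The quadric condition does not mention \<open>i\<close>, so the vertex groups are
  trivial for all of the lines or for none.\<close>

theorem corollary2p1p5:
  fixes L :: "nat \<Rightarrow> ('a::field ^ 4) set" and s :: nat
  assumes "s \<ge> 3"
    and "skew_lines s L"
  shows "\<forall>i\<in>{1..s}.
    (\<forall>p\<in>points_of (L i).
      (line_orbit_on s L i p i = {p} \<longleftrightarrow> (\<exists>T. transversal s L T \<and> p \<in> points_of T)) \<and>
      (\<forall>T. transversal s L T \<and> p \<in> points_of T \<longrightarrow>
        line_orbit s L i p = points_of T \<inter> (\<Union>j\<in>{1..s}. points_of (L j)))) \<and>
    (card (vertex_group s L i) = 1 \<longleftrightarrow>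
      (\<exists>A. smooth_quadric A \<and> (\<forall>j\<in>{1..s}. points_of (L j) \<subseteq> quadric_points A)))"
proof (intro ballI conjI allI impI)
  fix i assume i: "i \<in> {1..s}"
  note s = assms(1) and sk = assms(2)
  {
    fix p assume p: "p \<in> points_of (L i)"
    show "line_orbit_on s L i p i = {p} \<longleftrightarrow> (\<exists>T. transversal s L T \<and> p \<in> points_of T)"
      using line_orbit_on_singleton_iff[OF sk s i p] .
    fix T assume "transversal s L T \<and> p \<in> points_of T"
    then show "line_orbit s L i p = points_of T \<inter> (\<Union>j\<in>{1..s}. points_of (L j))"
      using line_orbit_transversal[OF sk s i p] by blast
  next
    obtain j where j: "j \<in> {1..s}" "i \<noteq> j"
      using other_index[OF s, of i i] by metis
    show "card (vertex_group s L i) = 1 \<longleftrightarrow>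
      (\<exists>A. smooth_quadric A \<and> (\<forall>j\<in>{1..s}. points_of (L j) \<subseteq> quadric_points A))"
      unfolding card_vertex_group_eq_1_iff[OF sk s i]
      using transversals_imp_smooth_quadric[OF sk s i] smooth_quadric_transversal[OF sk i _ _ j]
      by meson
  }
qed

end
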